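(* For any (simple) graph $H$ with $k$ edges, $AR^*_s(H) \leq \binom{k+1}{2}$. Moreover, $AR^*_s(P_k) \leq \binom{k}{2}+1$ for every $k\geq 1$, $AR^*_s(C_k) \leq \binom{k}{2}$ for every $k\geq 3$, and $AR^*_s(M_k) = \binom{k+1}{2}$ for every $k\geq 1$.
   Context: $P_k$ is the path with $k$ edges, $C_k$ the cycle with $k$ edges, $M_k$ the matching with $k$ edges (all simple graphs). An edge-coloring of a graph (possibly with parallel edges) is proper if any two distinct edges sharing an endpoint (in particular parallel edges) receive distinct colors. An edge-colored graph is rainbow if all its edges have distinct colors. A copy of $H$ is a (not necessarily induced) subgraph isomorphic to $H$. $AR^*_s(H)$ is the smallest number of edges in a not necessarily simple finite graph $G$ (parallel edges are allowed) such that every proper edge-coloring of $G$ contains a rainbow copy of $H$. *)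

theory Defs
  imports Main "HOL-Library.Extended_Nat"
begin

record ('v, 'e) multigraph =
  verts :: "'v set"
  edges :: "'e set"
  ends :: "'e \<Rightarrow> 'v set"

text \<open>Every edge has exactly two endpoints, so parallel edges are allowed but loops are not.\<close>

definition finite_multigraph :: "('v, 'e) multigraph \<Rightarrow> bool" where
  "finite_multigraph G \<longleftrightarrow> finite (verts G) \<and> finite (edges G) \<and>
     (\<forall>e\<in>edges G. ends G e \<subseteq> verts G \<and> card (ends G e) = 2)"

definition finite_simple_graph :: "('v, 'e) multigraph \<Rightarrow> bool" where
  "finite_simple_graph G \<longleftrightarrow> finite_multigraph G \<and> inj_on (ends G) (edges G)"

definition subgraph :: "('v, 'e) multigraph \<Rightarrow> ('v, 'e) multigraph \<Rightarrow> bool" where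
  "subgraph S G \<longleftrightarrow> verts S \<subseteq> verts G \<and> edges S \<subseteq> edges G \<and>
     (\<forall>e\<in>edges S. ends S e = ends G e \<and> ends S e \<subseteq> verts S)"

definition isomorphic :: "('v, 'e) multigraph \<Rightarrow> ('w, 'f) multigraph \<Rightarrow> bool" where
  "isomorphic G H \<longleftrightarrow> (\<exists>f g. bij_betw f (verts G) (verts H) \<and> bij_betw g (edges G) (edges H) \<and>
     (\<forall>e\<in>edges G. ends H (g e) = f ` ends G e))"

definition proper_edge_coloring :: "('v, 'e) multigraph \<Rightarrow> ('e \<Rightarrow> 'c) \<Rightarrow> bool" where
  "proper_edge_coloring G c \<longleftrightarrow> (\<forall>e\<in>edges G. \<forall>e'\<in>edges G.
     e \<noteq> e' \<and> ends G e \<inter> ends G e' \<noteq> {} \<longrightarrow> c e \<noteq> c e')"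

definition rainbow :: "('v, 'e) multigraph \<Rightarrow> ('e \<Rightarrow> 'c) \<Rightarrow> bool" where
  "rainbow G c \<longleftrightarrow> inj_on c (edges G)"

definition has_rainbow_copy ::
  "('v, 'e) multigraph \<Rightarrow> ('e \<Rightarrow> 'c) \<Rightarrow> ('w, 'f) multigraph \<Rightarrow> bool" where
  "has_rainbow_copy G c H \<longleftrightarrow> (\<exists>S. subgraph S G \<and> isomorphic S H \<and> rainbow S c)"

text \<open>
  Vertices, edges and colors of the host graph are natural numbers; since host graphs are
  finite, this is no restriction up to isomorphism and renaming of colors. The value lies in
  \<^typ>\<open>enat\<close> so that it would be \<open>\<infinity>\<close>, rather than \<open>0\<close>, if no host graph existed;
  otherwise the infimum is attained.
\<close>

definition AR_star_s :: "('v, 'e) multigraph \<Rightarrow> enat" where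
  "AR_star_s H = Inf {enat (card (edges G)) | G :: (nat, nat) multigraph.
     finite_multigraph G \<and>
     (\<forall>c :: nat \<Rightarrow> nat. proper_edge_coloring G c \<longrightarrow> has_rainbow_copy G c H)}"

definition path_graph :: "nat \<Rightarrow> (nat, nat) multigraph" where
  "path_graph k = \<lparr>verts = {..k}, edges = {..<k}, ends = (\<lambda>i. {i, i + 1})\<rparr>"

text \<open>A simple graph only for \<open>k \<ge> 3\<close>.\<close>

definition cycle_graph :: "nat \<Rightarrow> (nat, nat) multigraph" where
  "cycle_graph k = \<lparr>verts = {..<k}, edges = {..<k}, ends = (\<lambda>i. {i, (i + 1) mod k})\<rparr>"

definition matching_graph :: "nat \<Rightarrow> (nat, nat) multigraph" where
  "matching_graph k = \<lparr>verts = {..<2 * k}, edges = {..<k}, ends = (\<lambda>i. {2 * i, 2 * i + 1})\<rparr>"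

end

theory Submission
  imports Defs
begin

text \<open>
  Upper bounds: order the edges of \<open>H\<close> and replace the \<open>i\<close>-th edge by more parallel copies than
  there are earlier edges disjoint from it. In a proper coloring the parallel copies have distinct
  colors, and earlier edges meeting the \<open>i\<close>-th one cannot share its color, so a rainbow copy of
  \<open>H\<close> can be chosen greedily.

  Lower bound for matchings: if the host contains a \<open>k\<close>-edge matching, give all of its edges one
  common color and color the rest inductively without a rainbow \<open>(k - 1)\<close>-matching; a rainbow
  \<open>k\<close>-matching would use the common color at most once.
\<close>

section \<open>Binomial sums, greedy choice and blow-ups by parallel edges\<close>

lemma sum_Suc_lessThan: "(\<Sum>i<k. Suc i) = (k + 1) choose 2"
  by (induction k) (auto simp: numeral_2_eq_2)

text \<open>These are the multiplicities for paths: only the term at \<open>i = 0\<close> is raised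
  from 0 to 1, which produces the extra 1.\<close>

lemma sum_max_one_lessThan:
  assumes "k \<ge> 1"
  shows "(\<Sum>i<k. max 1 i) = (k choose 2) + 1"
  using assms by (induction k rule: dec_induct) (auto simp: numeral_2_eq_2)

text \<open>Read \<open>col i s\<close> as the color of the \<open>s\<close>-th of
  \<open>m i\<close> parallel copies of edge \<open>i\<close>. Choices are made in increasing order
  of \<open>i\<close>, so only clashes with smaller indices matter.\<close>

lemma greedy_rainbow_choice:
  fixes col :: "nat \<Rightarrow> nat \<Rightarrow> 'c" and m :: "nat \<Rightarrow> nat"
  assumes parallel: "\<And>i. i < k \<Longrightarrow> inj_on (col i) {..<m i}"
    and adjacent: "\<And>i j s t. \<lbrakk>i < k; j < i; adj j i; s < m j; t < m i\<rbrakk> \<Longrightarrow> col j s \<noteq> col i t"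
    and mult: "\<And>i. i < k \<Longrightarrow> card {j. j < i \<and> \<not> adj j i} < m i"
  shows "\<exists>s. (\<forall>i<k. s i < m i) \<and> inj_on (\<lambda>i. col i (s i)) {..<k}"
proof -
  have "\<exists>s. (\<forall>i<n. s i < m i) \<and> inj_on (\<lambda>i. col i (s i)) {..<n}" if "n \<le> k" for n
    using that
  proof (induction n)
    case 0
    then show ?case by simp
  next
    case (Suc n)
    then obtain s where s: "\<And>i. i < n \<Longrightarrow> s i < m i" "inj_on (\<lambda>i. col i (s i)) {..<n}"
      by auto
    have n: "n < k" using Suc.prems by simp
    \<comment> \<open>Only the colors chosen at indices in \<open>J\<close> can recur among the
      colors of class \<open>n\<close>. They are fewer than \<open>m n\<close>, so some color of the
      class is still free.\<close>
    define J where "J = {j. j < n \<and> \<not> adj j n}"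
    have "finite J" unfolding J_def by simp
    then have "card ((\<lambda>j. col j (s j)) ` J) \<le> card J" by (rule card_image_le)
    also have "\<dots> < card (col n ` {..<m n})"
      using mult[OF n] card_image[OF parallel[OF n]] by (simp add: J_def)
    finally have "\<not> col n ` {..<m n} \<subseteq> (\<lambda>j. col j (s j)) ` J"
      using card_mono[of "(\<lambda>j. col j (s j)) ` J" "col n ` {..<m n}"] \<open>finite J\<close> by auto
    then obtain t where t: "t < m n" "\<And>j. j \<in> J \<Longrightarrow> col n t \<noteq> col j (s j)" by blast
    have new: "col j (s j) \<noteq> col n t" if "j < n" for j
    proof (cases "adj j n")
      case True
      then show ?thesis using adjacent[OF n that _ s(1)[OF that] t(1)] by blast
    next
      case False
      then show ?thesis using t(2)[of j] that by (simp add: J_def)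
    qed
    have "inj_on (\<lambda>i. col i ((s(n := t)) i)) {..<Suc n}"
      using s(2) new by (auto simp: inj_on_def less_Suc_eq) metis+
    moreover have "\<forall>i<Suc n. (s(n := t)) i < m i"
      using s(1) t(1) by (auto simp: less_Suc_eq)
    ultimately show ?case by blast
  qed
  then show ?thesis by simp
qed

lemma AR_star_s_le_sum:
  fixes H :: "('v, 'e) multigraph" and m :: "nat \<Rightarrow> nat"
  assumes H: "finite_multigraph H"
    and e: "bij_betw e {..<k} (edges H)"
    and mult: "\<And>i. i < k \<Longrightarrow> card {j. j < i \<and> ends H (e j) \<inter> ends H (e i) = {}} < m i"
  shows "AR_star_s H \<le> enat (\<Sum>i<k. m i)"
proof -
  obtain f :: "'v \<Rightarrow> nat" where f: "inj_on f (verts H)"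
    using H finite_imp_inj_to_nat_seg unfolding finite_multigraph_def by metis
  \<comment> \<open>The host is \<open>H\<close> with its vertices renamed by \<open>f\<close>, as
    hosts live on naturals; \<open>prod_encode (i, s)\<close> is the \<open>s\<close>-th copy of
    edge \<open>e i\<close>.\<close>
  define G :: "(nat, nat) multigraph" where
    "G = \<lparr>verts = f ` verts H, edges = prod_encode ` Sigma {..<k} (\<lambda>i. {..<m i}),
          ends = (\<lambda>n. f ` ends H (e (fst (prod_decode n))))\<rparr>"
  have eH: "e i \<in> edges H" if "i < k" for i
    using e that by (auto simp: bij_betw_def)
  have endsH: "ends H (e i) \<subseteq> verts H" "card (ends H (e i)) = 2" if "i < k" for i
    using H eH[OF that] by (auto simp: finite_multigraph_def)
  have cardends: "card (f ` ends H (e i)) = 2" if "i < k" for i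
    using endsH[OF that] f by (metis card_image inj_on_subset)
  have "card (edges G) = card (Sigma {..<k} (\<lambda>i. {..<m i}))"
    unfolding G_def by (simp add: card_image inj_prod_encode)
  then have cardG: "card (edges G) = (\<Sum>i<k. m i)" by simp
  have finG: "finite_multigraph G"
    using H endsH cardends by (fastforce simp: finite_multigraph_def G_def)
  have copy: "has_rainbow_copy G c H" if c: "proper_edge_coloring G c" for c :: "nat \<Rightarrow> nat"
  proof -
    have edgeG: "prod_encode (i, s) \<in> edges G" if "i < k" "s < m i" for i s
      using that by (auto simp: G_def)
    have proper: "c (prod_encode (i, s)) \<noteq> c (prod_encode (j, t))"
      if "i < k" "s < m i" "j < k" "t < m j" "(i, s) \<noteq> (j, t)"
        "ends H (e i) \<inter> ends H (e j) \<noteq> {}" for i s j t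
    proof -
      have "ends G (prod_encode (i, s)) \<inter> ends G (prod_encode (j, t)) \<noteq> {}"
        using that(6) by (auto simp: G_def)
      then show ?thesis
        using c edgeG that by (auto simp: proper_edge_coloring_def)
    qed
    have "\<exists>s. (\<forall>i<k. s i < m i) \<and> inj_on (\<lambda>i. c (prod_encode (i, s i))) {..<k}"
    proof (rule greedy_rainbow_choice[where adj = "\<lambda>j i. ends H (e j) \<inter> ends H (e i) \<noteq> {}"])
      show "inj_on (\<lambda>s. c (prod_encode (i, s))) {..<m i}" if "i < k" for i
        \<comment> \<open>Two copies of the same edge share endpoints because an edge has two of
          them, hence a nonempty set.\<close>
        using proper[of i _ i] endsH(2)[OF that] that by (fastforce simp: inj_on_def)
    qed (use proper mult in auto)
    then obtain s where s: "\<And>i. i < k \<Longrightarrow> s i < m i"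
      and rb: "inj_on (\<lambda>i. c (prod_encode (i, s i))) {..<k}" by auto
    \<comment> \<open>One chosen copy of each edge; all vertices are kept so that isolated vertices
      of \<open>H\<close> are matched as well.\<close>
    define S :: "(nat, nat) multigraph" where
      "S = \<lparr>verts = verts G, edges = (\<lambda>i. prod_encode (i, s i)) ` {..<k}, ends = ends G\<rparr>"
    have "subgraph S G"
      using edgeG s finG by (auto simp: subgraph_def S_def finite_multigraph_def)
    moreover have "isomorphic S H"
      unfolding isomorphic_def
    proof (intro exI conjI ballI)
      show "bij_betw (inv_into (verts H) f) (verts S) (verts H)"
        using f by (simp add: S_def G_def bij_betw_inv_into inj_on_imp_bij_betw)
      have "bij_betw (\<lambda>n. fst (prod_decode n)) (edges S) {..<k}"
        by (rule bij_betw_byWitness[where f' = "\<lambda>i. prod_encode (i, s i)"]) (auto simp: S_def)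
      from bij_betw_trans[OF this e]
      show "bij_betw (e \<circ> (\<lambda>n. fst (prod_decode n))) (edges S) (edges H)" .
      show "ends H ((e \<circ> (\<lambda>n. fst (prod_decode n))) x) = inv_into (verts H) f ` ends S x"
        if "x \<in> edges S" for x
      proof -
        from that obtain i where i: "i < k" "x = prod_encode (i, s i)" by (auto simp: S_def)
        show ?thesis
          using inv_into_image_cancel[OF f endsH(1)[OF i(1)]] i by (simp add: S_def G_def)
      qed
    qed
    moreover have "rainbow S c"
      using rb by (auto simp: rainbow_def S_def inj_on_def)
    ultimately show ?thesis unfolding has_rainbow_copy_def by blast
  qed
  show ?thesis
    unfolding AR_star_s_def cardG[symmetric] by (rule Inf_lower) (use finG copy in blast)
qed

section \<open>Upper bounds for general graphs, paths and cycles\<close>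

lemma AR_star_s_le_choose:
  assumes "finite_multigraph H"
  shows "AR_star_s H \<le> enat ((card (edges H) + 1) choose 2)"
proof -
  have "finite (edges H)" using assms by (simp add: finite_multigraph_def)
  then obtain e where e: "bij_betw e {..<card (edges H)} (edges H)"
    using ex_bij_betw_nat_finite by (metis atLeast0LessThan)
  \<comment> \<open>In any order, edge \<open>i\<close> has only \<open>i\<close> predecessors, so
    \<open>Suc i\<close> copies suffice.\<close>
  have "card {j. j < i \<and> ends H (e j) \<inter> ends H (e i) = {}} < Suc i" for i
    using card_mono[of "{..<i}" "{j. j < i \<and> ends H (e j) \<inter> ends H (e i) = {}}"]
    by (auto simp: less_Suc_eq_le)
  from AR_star_s_le_sum[OF assms e this] show ?thesis
    by (simp only: sum_Suc_lessThan)
qed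

lemma AR_star_s_path_le:
  assumes "k \<ge> 1"
  shows "AR_star_s (path_graph k) \<le> enat ((k choose 2) + 1)"
proof -
  have "AR_star_s (path_graph k) \<le> enat (\<Sum>i<k. max 1 i)"
  proof (rule AR_star_s_le_sum[where e = id])
    show "finite_multigraph (path_graph k)"
      by (auto simp: finite_multigraph_def path_graph_def)
    show "bij_betw id {..<k} (edges (path_graph k))"
      by (simp add: path_graph_def)
    fix i
    \<comment> \<open>Edge \<open>i\<close> meets its predecessor \<open>i - 1\<close>, which saves
      one copy. For \<open>i = 0\<close> the bound is the empty set, and \<open>max 1 i\<close>
      still provides a copy.\<close>
    have "{j. j < i \<and> ends (path_graph k) (id j) \<inter> ends (path_graph k) (id i) = {}} \<subseteq> {..<i - 1}"
      by (auto simp: path_graph_def)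
    from card_mono[OF _ this]
    show "card {j. j < i \<and> ends (path_graph k) (id j) \<inter> ends (path_graph k) (id i) = {}} < max 1 i"
      by simp
  qed
  then show ?thesis by (simp only: sum_max_one_lessThan[OF assms])
qed

lemma AR_star_s_cycle_le:
  assumes "k \<ge> 3"
  shows "AR_star_s (cycle_graph k) \<le> enat (k choose 2)"
proof -
  define n where "n = k - 1"
  have k: "k = Suc n" and n: "n \<ge> 2" using assms by (auto simp: n_def)
  \<comment> \<open>The closing edge \<open>n\<close> meets two earlier edges, so it needs one copy less than in a path.\<close>
  define m where "m i = (if i = n then n - 1 else max 1 i)" for i
  have "AR_star_s (cycle_graph k) \<le> enat (\<Sum>i<k. m i)"
  proof (rule AR_star_s_le_sum[where e = id])
    \<comment> \<open>No edge of the cycle is a loop, including the closing one.\<close>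
    have "i \<noteq> Suc i mod k" if "i < k" for i
      using that n by (cases "i = n") (auto simp: k)
    then show "finite_multigraph (cycle_graph k)"
      using n by (auto simp: finite_multigraph_def cycle_graph_def k)
    show "bij_betw id {..<k} (edges (cycle_graph k))"
      by (simp add: cycle_graph_def)
    fix i assume i: "i < k"
    let ?J = "{j. j < i \<and> ends (cycle_graph k) (id j) \<inter> ends (cycle_graph k) (id i) = {}}"
    show "card ?J < m i"
    proof (cases "i = n")
      case True
      \<comment> \<open>The closing edge shares vertex \<open>0\<close> with edge \<open>0\<close>
        and vertex \<open>n\<close> with edge \<open>n - 1\<close>, leaving at most
        \<open>n - 2\<close> disjoint edges.\<close>
      have "?J \<subseteq> {1..<n - 1}"
      proof
        fix j assume j: "j \<in> ?J"
        then have "j \<noteq> 0" using True by (auto simp: cycle_graph_def k)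
        moreover have "j \<noteq> n - 1" using j True n by (auto simp: cycle_graph_def k)
        ultimately show "j \<in> {1..<n - 1}" using j True by auto
      qed
      from card_mono[OF _ this] show ?thesis using True n by (simp add: m_def)
    next
      case False
      have "?J \<subseteq> {..<i - 1}"
      proof
        fix j assume j: "j \<in> ?J"
        then have "Suc j \<noteq> i" using i by (auto simp: cycle_graph_def)
        then show "j \<in> {..<i - 1}" using j by auto
      qed
      from card_mono[OF _ this] show ?thesis using False by (simp add: m_def)
    qed
  qed
  also have "(\<Sum>i<k. m i) = (\<Sum>i<n. max 1 i) + (n - 1)"
    by (simp add: k m_def)
  \<comment> \<open>The sum is \<open>(n choose 2) + 1 + (n - 1)\<close>, which is
    \<open>Suc n choose 2\<close> by Pascal's rule.\<close>
  also have "\<dots> = k choose 2"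
    using n by (subst sum_max_one_lessThan) (auto simp: k numeral_2_eq_2)
  finally show ?thesis .
qed

section \<open>Lower bound for matchings\<close>

lemma coloring_without_rainbow_matching:
  fixes v :: "'e \<Rightarrow> 'v set"
  assumes "finite E" and "card E < (k + 1) choose 2"
  shows "\<exists>c :: 'e \<Rightarrow> nat. (\<forall>e\<in>E. \<forall>e'\<in>E. e \<noteq> e' \<and> v e \<inter> v e' \<noteq> {} \<longrightarrow> c e \<noteq> c e') \<and>
    (\<forall>A\<subseteq>E. card A = k \<and> pairwise (\<lambda>e e'. v e \<inter> v e' = {}) A \<longrightarrow> \<not> inj_on c A)"
  using assms
proof (induction k arbitrary: E)
  case 0
  \<comment> \<open>Vacuous, since \<open>1 choose 2\<close> is 0.\<close>
  then show ?case by (simp add: numeral_2_eq_2)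
next
  case (Suc k)
  show ?case
  proof (cases "\<exists>M\<subseteq>E. card M = Suc k \<and> pairwise (\<lambda>e e'. v e \<inter> v e' = {}) M")
    case False
    \<comment> \<open>Without a large matching any proper coloring will do, for instance an
      injective one.\<close>
    obtain c :: "'e \<Rightarrow> nat" where "inj_on c E"
      using finite_imp_inj_to_nat_seg[OF Suc.prems(1)] by blast
    then show ?thesis
      using False by (intro exI[of _ c]) (auto simp: inj_on_def)
  next
    case True
    then obtain M where M: "M \<subseteq> E" "card M = Suc k"
      "pairwise (\<lambda>e e'. v e \<inter> v e' = {}) M" by blast
    have "card (E - M) = card E - Suc k"
      using M Suc.prems(1) by (metis card_Diff_subset finite_subset)
    moreover have "Suc k \<le> card E"
      using M Suc.prems(1) by (metis card_mono)
    \<comment> \<open>By Pascal's rule the threshold drops by exactly \<open>Suc k\<close>, the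
      number of edges removed.\<close>
    ultimately have "card (E - M) < (k + 1) choose 2"
      using Suc.prems(2) by (simp add: numeral_2_eq_2)
    then obtain c :: "'e \<Rightarrow> nat" where
      c: "\<forall>e\<in>E - M. \<forall>e'\<in>E - M. e \<noteq> e' \<and> v e \<inter> v e' \<noteq> {} \<longrightarrow> c e \<noteq> c e'"
      and nr: "\<forall>A\<subseteq>E - M. card A = k \<and> pairwise (\<lambda>e e'. v e \<inter> v e' = {}) A \<longrightarrow> \<not> inj_on c A"
      using Suc.IH[of "E - M"] Suc.prems(1) by auto
    \<comment> \<open>\<open>Suc\<close> keeps color 0 exclusive to \<open>M\<close>, whose edges
      may share it because they are disjoint.\<close>
    define d where "d e = (if e \<in> M then 0 else Suc (c e))" for e
    have "\<forall>e\<in>E. \<forall>e'\<in>E. e \<noteq> e' \<and> v e \<inter> v e' \<noteq> {} \<longrightarrow> d e \<noteq> d e'"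
      using c M(3) unfolding d_def pairwise_def by simp blast
    moreover have "\<not> inj_on d A"
      if A: "A \<subseteq> E" "card A = Suc k" "pairwise (\<lambda>e e'. v e \<inter> v e' = {}) A" for A
    proof
      assume inj: "inj_on d A"
      have "finite A" using A(2) card.infinite by fastforce
      have "card (A \<inter> M) \<le> 1"
        using inj \<open>finite A\<close> by (auto simp: card_le_Suc0_iff_eq inj_on_def d_def)
      moreover have "card A = card (A - M) + card (A \<inter> M)"
        using \<open>finite A\<close> by (metis card_Diff_subset_Int card_mono finite_Int inf_le1 le_add_diff_inverse2)
      ultimately have "k \<le> card (A - M)" using A(2) by simp
      \<comment> \<open>\<open>A\<close> may avoid \<open>M\<close> altogether, so
        \<open>A - M\<close> is cut down to the exact size \<open>k\<close> that \<open>nr\<close>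
        speaks about.\<close>
      then obtain B where B: "B \<subseteq> A - M" "card B = k"
        by (metis obtain_subset_with_card_n)
      have "inj_on c B"
      proof (rule inj_onI)
        fix x y assume xy: "x \<in> B" "y \<in> B" "c x = c y"
        then have "x \<in> A - M" "y \<in> A - M" using B(1) by auto
        then show "x = y"
          using xy(3) inj_onD[OF inj, of x y] by (simp add: d_def)
      qed
      moreover have "pairwise (\<lambda>e e'. v e \<inter> v e' = {}) B"
        using A(3) B(1) by (meson Diff_subset pairwise_subset subset_trans)
      ultimately show False using nr B A(1) by blast
    qed
    ultimately show ?thesis by blast
  qed
qed

lemma isomorphic_matching_graphD:
  assumes "isomorphic S (matching_graph k)"
  shows "card (edges S) = k" and "pairwise (\<lambda>e e'. ends S e \<inter> ends S e' = {}) (edges S)"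
proof -
  obtain f g where g: "bij_betw g (edges S) {..<k}"
    and fg: "\<And>e. e \<in> edges S \<Longrightarrow> {2 * g e, 2 * g e + 1} = f ` ends S e"
    using assms by (auto simp: isomorphic_def matching_graph_def)
  show "card (edges S) = k" using bij_betw_same_card[OF g] by simp
  show "pairwise (\<lambda>e e'. ends S e \<inter> ends S e' = {}) (edges S)"
  proof (rule pairwiseI, rule ccontr)
    fix e e' assume e: "e \<in> edges S" "e' \<in> edges S" "e \<noteq> e'" "ends S e \<inter> ends S e' \<noteq> {}"
    \<comment> \<open>The pairs \<open>{2 * a, 2 * a + 1}\<close> are disjoint for distinct
      \<open>a\<close>, so the image of a common vertex determines the edge index.\<close>
    then obtain x where "f x \<in> {2 * g e, 2 * g e + 1}" "f x \<in> {2 * g e', 2 * g e' + 1}"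
      using fg by blast
    then have "g e = g e'" by auto
    then show False using g e by (auto simp: bij_betw_def inj_on_def)
  qed
qed

lemma AR_star_s_matching_ge: "enat ((k + 1) choose 2) \<le> AR_star_s (matching_graph k)"
  unfolding AR_star_s_def
proof (rule Inf_greatest, safe)
  fix G :: "(nat, nat) multigraph"
  assume G: "finite_multigraph G"
    and rb: "\<forall>c :: nat \<Rightarrow> nat. proper_edge_coloring G c \<longrightarrow> has_rainbow_copy G c (matching_graph k)"
  have "\<not> card (edges G) < (k + 1) choose 2"
  proof
    assume "card (edges G) < (k + 1) choose 2"
    moreover have "finite (edges G)" using G by (simp add: finite_multigraph_def)
    ultimately obtain c :: "nat \<Rightarrow> nat" where "proper_edge_coloring G c"
      and nr: "\<forall>A\<subseteq>edges G. card A = k \<and> pairwise (\<lambda>e e'. ends G e \<inter> ends G e' = {}) A \<longrightarrow> \<not> inj_on c A"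
      unfolding proper_edge_coloring_def
      using coloring_without_rainbow_matching[of "edges G" k "ends G"] by blast
    then obtain S where S: "subgraph S G" "isomorphic S (matching_graph k)" "rainbow S c"
      using rb by (auto simp: has_rainbow_copy_def)
    have "pairwise (\<lambda>e e'. ends G e \<inter> ends G e' = {}) (edges S)"
      using isomorphic_matching_graphD(2)[OF S(2)] S(1) by (auto simp: pairwise_def subgraph_def)
    then show False
      using nr S isomorphic_matching_graphD(1)[OF S(2)] by (auto simp: subgraph_def rainbow_def)
  qed
  then show "enat ((k + 1) choose 2) \<le> enat (card (edges G))" by simp
qed

lemma AR_star_s_matching: "AR_star_s (matching_graph k) = enat ((k + 1) choose 2)"
proof (rule antisym)
  have "finite_multigraph (matching_graph k)"
    by (auto simp: finite_multigraph_def matching_graph_def)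
  from AR_star_s_le_choose[OF this]
  show "AR_star_s (matching_graph k) \<le> enat ((k + 1) choose 2)"
    by (simp add: matching_graph_def)
qed (rule AR_star_s_matching_ge)

theorem theorem7:
  "(\<forall>(H :: ('v, 'e) multigraph) k.
      finite_simple_graph H \<and> card (edges H) = k \<longrightarrow> AR_star_s H \<le> enat ((k + 1) choose 2)) \<and>
   (\<forall>k\<ge>1. AR_star_s (path_graph k) \<le> enat ((k choose 2) + 1)) \<and>
   (\<forall>k\<ge>3. AR_star_s (cycle_graph k) \<le> enat (k choose 2)) \<and>
   (\<forall>k\<ge>1. AR_star_s (matching_graph k) = enat ((k + 1) choose 2))"
  using AR_star_s_le_choose AR_star_s_path_le AR_star_s_cycle_le AR_star_s_matching
  unfolding finite_simple_graph_def by blast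

end
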